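(* Let $S$ be a densely defined symmetric operator in a complex Hilbert space $\mathcal{H}$, with closure $\overline{S}$, such that $0$ is a regular point of $\overline{S}$ (i.e. $\overline{S}$ is injective with bounded inverse on $\mathrm{ran}\,\overline{S}$) and such that the deficiency index satisfies $d(S)\geqslant 1$. Let $S_{\mathrm{D}}$ be the distinguished self-adjoint extension of $S$, with everywhere defined and bounded inverse. Let $\widetilde{S}$ be a self-adjoint extension of $S$ in $\mathcal{H}$. For arbitrary $\varepsilon>0$ let $U_\varepsilon:\ker(S^*-\mathrm{i}\varepsilon\mathbf{1})\to\ker(S^*+\mathrm{i}\varepsilon\mathbf{1})$ be the unitary von Neumann extension parameter of $\widetilde{S}$ at the spectral point $\mathrm{i}\varepsilon$ (see context), so that an arbitrary $g\in\mathcal{D}(\widetilde{S})$ is decomposed as $$g=f_\varepsilon^{(g)}+u_\varepsilon^{(g)}-U_\varepsilon u_\varepsilon^{(g)}$$ with $f_\varepsilon^{(g)}\in\mathcal{D}(\overline{S})$ and $u_\varepsilon^{(g)}\in\ker(S^*-\mathrm{i}\varepsilon\mathbf{1})$ uniquely determined by $g$. Then the domain and the matrix elements of the self-adjoint (Kreĭn–Višik–Birman) extension parameter $T$ of $\widetilde{S}$ relative to $S_{\mathrm{D}}$ (see context) satisfy $$\mathcal{D}(T)=\Big\{u^{(g)}\in\ker S^*\;\Big|\;u^{(g)}:=\lim_{\varepsilon\downarrow 0}(\mathbf{1}-S_{\mathrm{D}}^{-1}\widetilde{S})(u_\varepsilon^{(g)}-U_\varepsilon u_\varepsilon^{(g)})\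 \text{ for some } g\in\mathcal{D}(\widetilde{S})\Big\},$$ $$\langle u^{(g)},Tu^{(g)}\rangle_{\mathcal{H}}=\lim_{\varepsilon\downarrow 0}\;\mathrm{i}\varepsilon\,\big\langle(\mathbf{1}-S_{\mathrm{D}}^{-1}\widetilde{S})(u_\varepsilon^{(g)}-U_\varepsilon u_\varepsilon^{(g)})\,,\,u_\varepsilon^{(g)}+U_\varepsilon u_\varepsilon^{(g)}\big\rangle_{\mathcal{H}}.$$
   Context: Scalar products are linear in the second entry and anti-linear in the first. $\mathbf{1}$ is the identity operator. Limits of vectors are in the norm of $\mathcal{H}$. The deficiency index $d(S):=\dim\ker(S^*-z\mathbf{1})$ is, under the given assumptions, the same cardinal for all $z\in\mathbb{C}^+\cup\{0\}\cup\mathbb{C}^-$. It is a known fact (Calkin) that $S$ then has a self-adjoint extension with everywhere defined bounded inverse on $\mathcal{H}$; $S_{\mathrm{D}}$ denotes one such extension, fixed once and for all. Von Neumann parameter (known classification): for each $\varepsilon>0$ there is a unique unitary $U_\varepsilon:\ker(S^*-\mathrm{i}\varepsilon\mathbf{1})\to\ker(S^*+\mathrm{i}\varepsilon\mathbf{1})$ (surjective isometry) such that $\mathcal{D}(\widetilde{S})=\mathcal{D}(\overline{S})\dotplus(\mathbf{1}-U_\varepsilon)\ker(S^*-\mathrm{i}\varepsilon\mathbf{1})$ and $\widetilde{S}(f+u-U_\varepsilon u)=\overline{S}f+\mathrm{i}\varepsilon u+\mathrm{i}\varepsilon U_\varepsilon u$ for $f\in\mathcal{D}(\overline{S})$, $u\in\ker(S^*-\mathrm{i}\varepsilon\mathbf{1})$.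 Kreĭn–Višik–Birman parameter (known classification): there is a unique operator $T$, self-adjoint in a closed subspace of $\ker S^*$ (namely in the Hilbert space $\overline{\mathcal{D}(T)}\subset\ker S^*$), such that $\mathcal{D}(\widetilde{S})=\{f+S_{\mathrm{D}}^{-1}(Tu+w)+u : f\in\mathcal{D}(\overline{S}),\,u\in\mathcal{D}(T),\,w\in\ker S^*\cap\mathcal{D}(T)^\perp\}$ and $\widetilde{S}(f+S_{\mathrm{D}}^{-1}(Tu+w)+u)=\overline{S}f+Tu+w$. The representation of each element of $\mathcal{D}(\widetilde{S})$ in either form is unique. *)

theory Defs
  imports "HOL-Analysis.Analysis"
begin

section \<open>Complex Hilbert spaces\<close>

text \<open>The inner product is anti-linear in the first and linear in the second entry. Completeness and
  the norm topology come from the superclass \<^class>\<open>banach\<close>.\<close>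

class chilbert_space = banach +
  fixes scaleC :: "complex \<Rightarrow> 'a \<Rightarrow> 'a"  (infixr "*\<^sub>C" 75)
    and cinner :: "'a \<Rightarrow> 'a \<Rightarrow> complex"
  assumes scaleC_add_right: "a *\<^sub>C (x + y) = a *\<^sub>C x + a *\<^sub>C y"
    and scaleC_add_left: "(a + b) *\<^sub>C x = a *\<^sub>C x + b *\<^sub>C x"
    and scaleC_scaleC: "a *\<^sub>C (b *\<^sub>C x) = (a * b) *\<^sub>C x"
    and scaleC_one: "1 *\<^sub>C x = x"
    and scaleR_scaleC: "r *\<^sub>R x = complex_of_real r *\<^sub>C x"
    and cinner_commute: "cinner x y = cnj (cinner y x)"
    and cinner_add_right: "cinner x (y + z) = cinner x y + cinner x z"
    and cinner_scaleC_right: "cinner x (a *\<^sub>C y) = a * cinner x y"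
    and cinner_self_nonneg: "0 \<le> Re (cinner x x)"
    and cinner_eq_zero_iff: "cinner x x = 0 \<longleftrightarrow> x = 0"
    and norm_eq_sqrt_cinner: "norm x = sqrt (Re (cinner x x))"

definition csubspace :: "'a::chilbert_space set \<Rightarrow> bool" where
  "csubspace M \<longleftrightarrow> 0 \<in> M \<and> (\<forall>x\<in>M. \<forall>y\<in>M. x + y \<in> M) \<and> (\<forall>c. \<forall>x\<in>M. c *\<^sub>C x \<in> M)"

definition orthogonal_complement :: "'a::chilbert_space set \<Rightarrow> 'a set" where
  "orthogonal_complement M = {y. \<forall>x\<in>M. cinner x y = 0}"

text \<open>\<open>U\<close> is a total function, but only its values on \<open>K\<close> matter.\<close>

definition unitary_between :: "'a::chilbert_space set \<Rightarrow> 'a set \<Rightarrow> ('a \<Rightarrow> 'a) \<Rightarrow> bool" where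
  "unitary_between K L U \<longleftrightarrow>
     (\<forall>x\<in>K. \<forall>y\<in>K. U (x + y) = U x + U y) \<and> (\<forall>c. \<forall>x\<in>K. U (c *\<^sub>C x) = c *\<^sub>C U x) \<and>
     (\<forall>x\<in>K. norm (U x) = norm x) \<and> U ` K = L"

definition is_orthonormal_basis :: "'a::chilbert_space set \<Rightarrow> 'a set \<Rightarrow> bool" where
  "is_orthonormal_basis M B \<longleftrightarrow>
     B \<subseteq> M \<and> (\<forall>x\<in>B. \<forall>y\<in>B. cinner x y = (if x = y then 1 else 0)) \<and>
     (\<lambda>V. csubspace V \<and> closed V) hull B = M"

text \<open>The Hilbert space dimension of a closed subspace, as a cardinal; all orthonormal bases of a
  closed subspace have the same cardinality.\<close>

definition hilbert_dim :: "'a::chilbert_space set \<Rightarrow> 'a rel" where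
  "hilbert_dim M = card_of (SOME B. is_orthonormal_basis M B)"


section \<open>Unbounded operators\<close>

text \<open>An operator is represented by its graph. Thus the domain, range and inverse of \<open>A\<close> are
  \<^term>\<open>Domain A\<close>, \<^term>\<open>Range A\<close> and \<^term>\<open>converse A\<close>, the closure of \<open>A\<close> is its topological
  closure in the product space, and \<open>A \<subseteq> B\<close> says that \<open>B\<close> extends \<open>A\<close>.\<close>

definition linear_operator :: "'a::chilbert_space rel \<Rightarrow> bool" where
  "linear_operator A \<longleftrightarrow> single_valued A \<and> (0, 0) \<in> A \<and>
     (\<forall>x y x' y'. (x, y) \<in> A \<longrightarrow> (x', y') \<in> A \<longrightarrow> (x + x', y + y') \<in> A) \<and>
     (\<forall>c x y. (x, y) \<in> A \<longrightarrow> (c *\<^sub>C x, c *\<^sub>C y) \<in> A)"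

text \<open>The value of \<open>A\<close> at \<open>x\<close>; meaningful only for \<open>x \<in> Domain A\<close>.\<close>

definition app :: "'a rel \<Rightarrow> 'a \<Rightarrow> 'a"  (infixr "\<cdot>" 90) where
  "A \<cdot> x = (THE y. (x, y) \<in> A)"

text \<open>The operator \<open>A - z1\<close>.\<close>

definition shift :: "'a::chilbert_space rel \<Rightarrow> complex \<Rightarrow> 'a rel" where
  "shift A z = {(x, y - z *\<^sub>C x) | x y. (x, y) \<in> A}"

definition kernel :: "'a::chilbert_space rel \<Rightarrow> 'a set" where
  "kernel A = {x. (x, 0) \<in> A}"

definition densely_defined :: "'a::chilbert_space rel \<Rightarrow> bool" where
  "densely_defined A \<longleftrightarrow> closure (Domain A) = UNIV"

definition symmetric_operator :: "'a::chilbert_space rel \<Rightarrow> bool" where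
  "symmetric_operator A \<longleftrightarrow> (\<forall>(x, y)\<in>A. \<forall>(x', y')\<in>A. cinner y x' = cinner x y')"

text \<open>The adjoint of \<open>A\<close> taken in the Hilbert space \<open>K\<close>, a closed subspace of the ambient space
  containing domain and range of \<open>A\<close>.\<close>

definition adjoint_in :: "'a::chilbert_space set \<Rightarrow> 'a rel \<Rightarrow> 'a rel" where
  "adjoint_in K A = {(x, y). x \<in> K \<and> y \<in> K \<and> (\<forall>(v, w)\<in>A. cinner w x = cinner v y)}"

definition selfadjoint_in :: "'a::chilbert_space set \<Rightarrow> 'a rel \<Rightarrow> bool" where
  "selfadjoint_in K A \<longleftrightarrow> csubspace K \<and> closed K \<and> linear_operator A \<and>
     A \<subseteq> K \<times> K \<and> closure (Domain A) = K \<and> adjoint_in K A = A"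

abbreviation adjoint_op :: "'a::chilbert_space rel \<Rightarrow> 'a rel" where
  "adjoint_op \<equiv> adjoint_in UNIV"

abbreviation selfadjoint :: "'a::chilbert_space rel \<Rightarrow> bool" where
  "selfadjoint \<equiv> selfadjoint_in UNIV"

definition has_bounded_inverse :: "'a::chilbert_space rel \<Rightarrow> bool" where
  "has_bounded_inverse A \<longleftrightarrow>
     single_valued (converse A) \<and> (\<exists>C. \<forall>(y, x) \<in> converse A. norm x \<le> C * norm y)"

text \<open>The inverse of \<open>A - z1\<close> need only be defined on the range of \<open>A - z1\<close>.\<close>

definition regular_point :: "'a::chilbert_space rel \<Rightarrow> complex \<Rightarrow> bool" where
  "regular_point A z \<longleftrightarrow> has_bounded_inverse (shift A z)"

definition deficiency_index :: "'a::chilbert_space rel \<Rightarrow> complex \<Rightarrow> 'a rel" where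
  "deficiency_index S z = hilbert_dim (kernel (shift (adjoint_op S) z))"


section \<open>Parametrisations of self-adjoint extensions\<close>

text \<open>\<open>U\<close> is the von Neumann parameter, at the spectral point \<open>\<i>\<epsilon>\<close>, of the self-adjoint extension
  \<open>A\<close> of \<open>S\<close>. The third conjunct says that the sum in the second one is direct.\<close>

definition von_neumann_parameter ::
    "'a::chilbert_space rel \<Rightarrow> 'a rel \<Rightarrow> real \<Rightarrow> ('a \<Rightarrow> 'a) \<Rightarrow> bool" where
  "von_neumann_parameter S A \<epsilon> U \<longleftrightarrow>
     (let z = \<i> * complex_of_real \<epsilon>;
          K = kernel (shift (adjoint_op S) z);
          L = kernel (shift (adjoint_op S) (- z))
      in unitary_between K L U \<and>
         Domain A = {f + (u - U u) | f u. f \<in> Domain (closure S) \<and> u \<in> K} \<and>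
         Domain (closure S) \<inter> (\<lambda>u. u - U u) ` K = {0} \<and>
         (\<forall>f\<in>Domain (closure S). \<forall>u\<in>K.
            A \<cdot> (f + u - U u) = closure S \<cdot> f + z *\<^sub>C u + z *\<^sub>C U u))"

text \<open>\<open>T\<close> is the Krein-Visik-Birman parameter, relative to the distinguished extension \<open>SD\<close>, of the
  self-adjoint extension \<open>A\<close> of \<open>S\<close>.\<close>

definition kvb_parameter ::
    "'a::chilbert_space rel \<Rightarrow> 'a rel \<Rightarrow> 'a rel \<Rightarrow> 'a rel \<Rightarrow> bool" where
  "kvb_parameter S SD A T \<longleftrightarrow>
     (let N = kernel (adjoint_op S);
          W = N \<inter> orthogonal_complement (Domain T)
      in closure (Domain T) \<subseteq> N \<and> selfadjoint_in (closure (Domain T)) T \<and>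
         Domain A = {f + converse SD \<cdot> (T \<cdot> u + w) + u | f u w.
                       f \<in> Domain (closure S) \<and> u \<in> Domain T \<and> w \<in> W} \<and>
         (\<forall>f\<in>Domain (closure S). \<forall>u\<in>Domain T. \<forall>w\<in>W.
            A \<cdot> (f + converse SD \<cdot> (T \<cdot> u + w) + u) = closure S \<cdot> f + T \<cdot> u + w))"

end

theory Submission
  imports Defs
begin

text \<open>Both expressions are in fact independent of \<open>\<epsilon>\<close>. Since \<open>SD\<close> and \<open>St\<close> agree on the domain of the
  closure of \<open>S\<close>, the map \<open>1 - SD\<^sup>-\<^sup>1 St\<close> annihilates that domain, so it sends \<open>u\<^sub>\<epsilon> - U\<^sub>\<epsilon> u\<^sub>\<epsilon> = g - f\<^sub>\<epsilon>\<close> and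
  \<open>g = f + SD\<^sup>-\<^sup>1 (T x + w) + x\<close> to the same vector, namely \<open>x\<close>. Moreover
  \<open>\<i>\<epsilon> (u\<^sub>\<epsilon> + U\<^sub>\<epsilon> u\<^sub>\<epsilon>) = St g - S f\<^sub>\<epsilon>\<close> (with \<open>S\<close> closed), and pairing this with \<open>x\<close> leaves only \<open>\<langle>x, T x\<rangle>\<close>,
  because \<open>x\<close> is orthogonal to the range of the closure of \<open>S\<close> and to \<open>w\<close>.\<close>

lemma cinner_add_left: "cinner (x + y) z = cinner x z + cinner y z"
  by (metis cinner_commute cinner_add_right complex_cnj_add)

lemma cinner_scaleC_left: "cinner (a *\<^sub>C x) y = cnj a * cinner x y"
  by (metis cinner_commute cinner_scaleC_right complex_cnj_mult)

lemma scaleC_minus_one: "(-1) *\<^sub>C x = - (x :: 'a::chilbert_space)"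
  using scaleR_scaleC[of "-1" x] by simp

lemma cinner_minus_right: "cinner x (- y) = - cinner x y"
  using cinner_scaleC_right[of x "-1" y] by (simp add: scaleC_minus_one)

lemma cinner_minus_left: "cinner (- x) y = - cinner x y"
  using cinner_scaleC_left[of "-1" x y] by (simp add: scaleC_minus_one)

lemma cinner_diff_right: "cinner x (y - z) = cinner x y - cinner x z"
  using cinner_add_right[of x y "- z"] by (simp add: cinner_minus_right)

lemma cinner_diff_left: "cinner (x - y) z = cinner x z - cinner y z"
  using cinner_add_left[of x "- y" z] by (simp add: cinner_minus_left)

lemma cinner_zero_right: "cinner x 0 = 0"
  using cinner_diff_right[of x 0 0] by simp

lemma cinner_zero_left: "cinner 0 x = 0"
  using cinner_diff_left[of 0 0 x] by simp

lemma norm_sq_cinner: "(norm x)\<^sup>2 = Re (cinner x x)"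
  by (simp add: norm_eq_sqrt_cinner cinner_self_nonneg)

text \<open>Reduces the inner product to norms, so that its continuity can be derived from that of
  the norm.\<close>

lemma Re_cinner_polarization: "Re (cinner x y) = ((norm (x + y))\<^sup>2 - (norm (x - y))\<^sup>2) / 4"
proof -
  have "Re (cinner y x) = Re (cinner x y)"
    by (subst cinner_commute) simp
  then show ?thesis
    by (simp add: norm_sq_cinner cinner_add_left cinner_add_right cinner_diff_left cinner_diff_right)
qed

lemma continuous_on_cinner_right [continuous_intros]:
  assumes "continuous_on A f"
  shows "continuous_on A (\<lambda>y. cinner x (f y))"
proof -
  \<comment> \<open>By anti-linearity in the first entry, \<open>cinner (\<i> *\<^sub>C x) y\<close>
    is \<open>- \<i>\<close> times \<open>cinner x y\<close>, so its real part is the missing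
    imaginary part.\<close>
  have "cinner x y = Complex (Re (cinner x y)) (Re (cinner (\<i> *\<^sub>C x) y))" for y
    by (simp add: complex_eq_iff cinner_scaleC_left)
  then have "cinner x y =
      Complex (((norm (x + y))\<^sup>2 - (norm (x - y))\<^sup>2) / 4)
              (((norm (\<i> *\<^sub>C x + y))\<^sup>2 - (norm (\<i> *\<^sub>C x - y))\<^sup>2) / 4)" for y
    unfolding Re_cinner_polarization by blast
  then show ?thesis
    unfolding Complex_eq by (simp only:) (intro continuous_intros assms; simp)
qed

text \<open>Every pair in the graph of \<open>A\<close> contributes one condition, closed by
  continuity of the inner product.\<close>

lemma closed_adjoint_op: "closed (adjoint_op A)"
proof -
  have "adjoint_op A = (\<Inter>(v, w)\<in>A. {p. cinner w (fst p) = cinner v (snd p)})"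
    by (auto simp: adjoint_in_def)
  moreover have "closed {p. cinner w (fst p) = cinner v (snd p)}" for v w :: 'a
    by (intro closed_Collect_eq continuous_intros)
  ultimately show ?thesis
    by (auto intro!: closed_INT)
qed

text \<open>A self-adjoint operator equals its adjoint, so its graph is closed. Applied to
  \<open>SD\<close> and \<open>St\<close>, this makes both of them extend
  \<open>closure S\<close>.\<close>

lemma closure_subset_selfadjoint:
  assumes "selfadjoint A" "S \<subseteq> A"
  shows "closure S \<subseteq> A"
proof (rule closure_minimal)
  show "closed A"
    using assms(1) closed_adjoint_op[of A] by (simp add: selfadjoint_in_def)
qed (fact assms(2))

lemma linear_operator_add:
  "linear_operator A \<Longrightarrow> (x, y) \<in> A \<Longrightarrow> (x', y') \<in> A \<Longrightarrow> (x + x', y + y') \<in> A"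
  unfolding linear_operator_def by blast

lemma linear_operator_diff:
  assumes "linear_operator A" "(x, y) \<in> A" "(x', y') \<in> A"
  shows "(x - x', y - y') \<in> A"
proof -
  have "((-1) *\<^sub>C x', (-1) *\<^sub>C y') \<in> A"
    using assms(1,3) unfolding linear_operator_def by blast
  then show ?thesis
    using linear_operator_add[OF assms(1,2)] by (fastforce simp: scaleC_minus_one)
qed

lemma app_eqI: "single_valued A \<Longrightarrow> (x, y) \<in> A \<Longrightarrow> A \<cdot> x = y"
  unfolding app_def by (blast dest: single_valuedD)

lemma app_in: "single_valued A \<Longrightarrow> x \<in> Domain A \<Longrightarrow> (x, A \<cdot> x) \<in> A"
  by (auto simp: app_eqI)

text \<open>The kernel of the adjoint is orthogonal to the range of \<open>S\<close>, and continuity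
  carries this over to limits in the graph. This removes the \<open>closure S\<close> terms from the
  matrix elements.\<close>

lemma cinner_kernel_adjoint_closure:
  assumes "x \<in> kernel (adjoint_op S)" "(a, b) \<in> closure S"
  shows "cinner x b = 0"
proof -
  have "cinner x w = 0" if "(v, w) \<in> S" for v w
  proof -
    have "cinner w x = 0"
      using that assms(1) by (auto simp: kernel_def adjoint_in_def cinner_zero_right)
    then show ?thesis
      by (subst cinner_commute) simp
  qed
  then have "S \<subseteq> {p. cinner x (snd p) = 0}"
    by auto
  moreover have "closed {p :: 'a \<times> 'a. cinner x (snd p) = 0}"
    by (intro closed_Collect_eq continuous_intros)
  ultimately have "closure S \<subseteq> {p. cinner x (snd p) = 0}"
    by (rule closure_minimal)
  then show ?thesis
    using assms(2) by auto
qed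

theorem theorem3p3:
  fixes S SD St T :: "'a::chilbert_space rel"
    and z :: complex
    and U :: "real \<Rightarrow> 'a \<Rightarrow> 'a"
    and f u :: "real \<Rightarrow> 'a \<Rightarrow> 'a"
  assumes "linear_operator S" and "densely_defined S" and "symmetric_operator S"
    and "regular_point (closure S) 0"
    and "z = 0 \<or> Im z \<noteq> 0" and "(card_of {()}, deficiency_index S z) \<in> ordLeq"
    and "selfadjoint SD" and "S \<subseteq> SD" and "has_bounded_inverse SD" and "Range SD = UNIV"
    and "selfadjoint St" and "S \<subseteq> St"
    and "\<And>\<epsilon>. \<epsilon> > 0 \<Longrightarrow> von_neumann_parameter S St \<epsilon> (U \<epsilon>)"
    and "\<And>\<epsilon> g. \<epsilon> > 0 \<Longrightarrow> g \<in> Domain St \<Longrightarrow>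
           f \<epsilon> g \<in> Domain (closure S) \<and>
           u \<epsilon> g \<in> kernel (shift (adjoint_op S) (\<i> * complex_of_real \<epsilon>)) \<and>
           g = f \<epsilon> g + u \<epsilon> g - U \<epsilon> (u \<epsilon> g)"
    and "kvb_parameter S SD St T"
  defines "v \<equiv> \<lambda>\<epsilon> g. (u \<epsilon> g - U \<epsilon> (u \<epsilon> g)) - converse SD \<cdot> St \<cdot> (u \<epsilon> g - U \<epsilon> (u \<epsilon> g))"
  shows "\<exists>u0 :: 'a \<Rightarrow> 'a.
    (\<forall>g\<in>Domain St. ((\<lambda>\<epsilon>. v \<epsilon> g) \<longlongrightarrow> u0 g) (at_right 0)) \<and>
    Domain T = {x \<in> kernel (adjoint_op S). \<exists>g\<in>Domain St. x = u0 g} \<and>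
    (\<forall>g\<in>Domain St.
       ((\<lambda>\<epsilon>. \<i> * complex_of_real \<epsilon> * cinner (v \<epsilon> g) (u \<epsilon> g + U \<epsilon> (u \<epsilon> g)))
          \<longlongrightarrow> cinner (u0 g) (T \<cdot> u0 g)) (at_right 0))"
proof -
  let ?R = "converse SD"
  \<comment> \<open>The candidate limit applies \<open>1 - SD\<^sup>-\<^sup>1 St\<close> to all of
    \<open>g\<close>, so no \<epsilon> enters.\<close>
  define u0 where "u0 g = g - ?R \<cdot> St \<cdot> g" for g
  have linSt: "linear_operator St" and linSD: "linear_operator SD"
    using assms(7,11) by (auto simp: selfadjoint_in_def)
  then have svSt: "single_valued St"
    by (simp add: linear_operator_def)
  have svR: "single_valued ?R"
    using assms(9) by (simp add: has_bounded_inverse_def)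
  have clSt: "closure S \<subseteq> St" and clSD: "closure S \<subseteq> SD"
    using closure_subset_selfadjoint assms(7,8,11,12) by blast+
  have svS: "single_valued (closure S)"
    using svSt clSt by (meson single_valued_subset)
  \<comment> \<open>\<open>SD\<close> is onto, so its inverse has a value at every vector.\<close>
  have R: "(?R \<cdot> h, h) \<in> SD" for h
    using app_in[OF svR, of h] assms(10) by auto

  let ?W = "kernel (adjoint_op S) \<inter> orthogonal_complement (Domain T)"
  have kernel: "Domain T \<subseteq> kernel (adjoint_op S)"
    using assms(15) closure_subset[of "Domain T"] by (auto simp: kvb_parameter_def Let_def)
  have domSt: "Domain St = {f + ?R \<cdot> (T \<cdot> x + w) + x | f x w.
      f \<in> Domain (closure S) \<and> x \<in> Domain T \<and> w \<in> ?W}"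
    using assms(15) by (simp add: kvb_parameter_def Let_def)
  have appSt: "St \<cdot> (a + ?R \<cdot> (T \<cdot> x + w) + x) = closure S \<cdot> a + T \<cdot> x + w"
    if "a \<in> Domain (closure S)" "x \<in> Domain T" "w \<in> ?W" for a x w
    using assms(15) that by (simp add: kvb_parameter_def Let_def)

  \<comment> \<open>\<open>SD\<close> agrees with \<open>closure S\<close> at \<open>a\<close>, so
    \<open>?R\<close> maps the value of \<open>St\<close> back to
    \<open>a + ?R \<cdot> (T \<cdot> x + w)\<close>; subtracting this leaves
    \<open>x\<close>.\<close>
  have u0_kvb: "u0 (a + ?R \<cdot> (T \<cdot> x + w) + x) = x"
    if "a \<in> Domain (closure S)" "x \<in> Domain T" "w \<in> ?W" for a x w
  proof -
    have "(a, closure S \<cdot> a) \<in> SD"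
      using app_in[OF svS that(1)] clSD by blast
    from linear_operator_add[OF linSD this R[of "T \<cdot> x + w"]]
    have "?R \<cdot> (closure S \<cdot> a + T \<cdot> x + w) = a + ?R \<cdot> (T \<cdot> x + w)"
      by (intro app_eqI[OF svR]) (simp add: add.assoc)
    then show ?thesis
      using appSt[OF that] by (simp add: u0_def)
  qed

  \<comment> \<open>Of the three terms of \<open>St \<cdot> g\<close>, only
    \<open>T \<cdot> x\<close> survives the pairing with \<open>x\<close>:
    \<open>closure S \<cdot> a\<close> is orthogonal to the kernel of the adjoint, and
    \<open>w\<close> to \<open>Domain T\<close>.\<close>
  have u0: "u0 g \<in> Domain T" "cinner (u0 g) (St \<cdot> g) = cinner (u0 g) (T \<cdot> u0 g)"
    if g: "g \<in> Domain St" for g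
  proof -
    obtain a x w where a: "a \<in> Domain (closure S)" and x: "x \<in> Domain T" and w: "w \<in> ?W"
      and g_eq: "g = a + ?R \<cdot> (T \<cdot> x + w) + x"
      using g unfolding domSt mem_Collect_eq by (elim exE conjE)
    have [simp]: "u0 g = x"
      unfolding g_eq by (rule u0_kvb[OF a x w])
    have St_g: "St \<cdot> g = closure S \<cdot> a + T \<cdot> x + w"
      unfolding g_eq by (rule appSt[OF a x w])
    show "u0 g \<in> Domain T"
      using x by simp
    have "cinner x w = 0"
      using x w by (simp add: orthogonal_complement_def)
    moreover have "cinner x (closure S \<cdot> a) = 0"
      using x kernel app_in[OF svS a] by (blast intro: cinner_kernel_adjoint_closure)
    ultimately show "cinner (u0 g) (St \<cdot> g) = cinner (u0 g) (T \<cdot> u0 g)"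
      by (simp add: St_g cinner_add_right)
  qed

  have v: "v \<epsilon> g = u0 g"
    and form: "\<i> * complex_of_real \<epsilon> * cinner (v \<epsilon> g) (u \<epsilon> g + U \<epsilon> (u \<epsilon> g)) = cinner (u0 g) (T \<cdot> u0 g)"
    if \<epsilon>: "\<epsilon> > 0" and g: "g \<in> Domain St" for \<epsilon> g
  proof -
    let ?f = "f \<epsilon> g" and ?u = "u \<epsilon> g" and ?z = "\<i> * complex_of_real \<epsilon>"
    have fu: "?f \<in> Domain (closure S)" "?u \<in> kernel (shift (adjoint_op S) ?z)"
      and g_eq: "?f + ?u - U \<epsilon> ?u = g"
      using assms(14)[OF \<epsilon> g] by metis+
    then have f: "(?f, closure S \<cdot> ?f) \<in> closure S"
      by (intro app_in[OF svS])
    have uU: "?u - U \<epsilon> ?u = g - ?f"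
      by (subst g_eq[symmetric]) simp
    have "(g - ?f, St \<cdot> g - closure S \<cdot> ?f) \<in> St"
      using linear_operator_diff[OF linSt app_in[OF svSt g]] f clSt by blast
    then have *: "St \<cdot> (g - ?f) = St \<cdot> g - closure S \<cdot> ?f"
      by (rule app_eqI[OF svSt])
    \<comment> \<open>\<open>?R\<close> undoes \<open>closure S\<close> at \<open>?f\<close>, so
      \<open>?f\<close> is subtracted from both terms of \<open>v\<close> and cancels.\<close>
    have "(?R \<cdot> St \<cdot> g - ?f, St \<cdot> g - closure S \<cdot> ?f) \<in> SD"
      using linear_operator_diff[OF linSD R] f clSD by blast
    then have "?R \<cdot> (St \<cdot> g - closure S \<cdot> ?f) = ?R \<cdot> St \<cdot> g - ?f"
      by (intro app_eqI[OF svR]) simp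
    with * show v: "v \<epsilon> g = u0 g"
      unfolding v_def u0_def uU by simp
    have "St \<cdot> (?f + ?u - U \<epsilon> ?u) = closure S \<cdot> ?f + ?z *\<^sub>C ?u + ?z *\<^sub>C U \<epsilon> ?u"
      using assms(13)[OF \<epsilon>] fu unfolding von_neumann_parameter_def Let_def by blast
    then have "?z *\<^sub>C (?u + U \<epsilon> ?u) = St \<cdot> g - closure S \<cdot> ?f"
      by (simp add: g_eq scaleC_add_right)
    \<comment> \<open>Linearity in the second entry moves \<open>?z\<close> inside without
      conjugation, where the von Neumann formula has absorbed it.\<close>
    then have "?z * cinner (v \<epsilon> g) (?u + U \<epsilon> ?u)
        = cinner (u0 g) (St \<cdot> g) - cinner (u0 g) (closure S \<cdot> ?f)"
      by (metis v cinner_diff_right cinner_scaleC_right)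
    moreover have "cinner (u0 g) (closure S \<cdot> ?f) = 0"
      using u0(1)[OF g] kernel f by (blast intro: cinner_kernel_adjoint_closure)
    ultimately show "?z * cinner (v \<epsilon> g) (?u + U \<epsilon> ?u) = cinner (u0 g) (T \<cdot> u0 g)"
      using u0(2)[OF g] by simp
  qed

  \<comment> \<open>Each \<open>x\<close> is attained at the vector whose other parameters
    \<open>a\<close> and \<open>w\<close> vanish.\<close>
  have "\<exists>g\<in>Domain St. x = u0 g" if x: "x \<in> Domain T" for x
  proof -
    have S0: "(0, 0) \<in> S"
      using assms(1) by (simp add: linear_operator_def)
    then have a: "0 \<in> Domain (closure S)"
      using closure_subset[of S] by blast
    have w: "0 \<in> ?W"
      by (simp add: kernel_def adjoint_in_def orthogonal_complement_def cinner_zero_right cinner_zero_left)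
    show ?thesis
    proof
      show "x = u0 (0 + ?R \<cdot> (T \<cdot> x + 0) + x)"
        by (rule u0_kvb[OF a x w, symmetric])
      show "0 + ?R \<cdot> (T \<cdot> x + 0) + x \<in> Domain St"
        unfolding domSt mem_Collect_eq
        by (rule exI[of _ 0], rule exI[of _ x], rule exI[of _ 0]) (intro conjI refl a x w)
    qed
  qed
  then have "Domain T = {x \<in> kernel (adjoint_op S). \<exists>g\<in>Domain St. x = u0 g}"
    using u0(1) kernel by blast
  \<comment> \<open>Both functions are constant for positive \<epsilon>; the interval from 0 to 1 is
    an arbitrary right neighbourhood of 0.\<close>
  moreover have "((\<lambda>\<epsilon>. v \<epsilon> g) \<longlongrightarrow> u0 g) (at_right 0)" if "g \<in> Domain St" for g
    by (rule tendsto_eventually, rule eventually_at_rightI[of 0 1]) (use v that in auto)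
  moreover have "((\<lambda>\<epsilon>. \<i> * complex_of_real \<epsilon> * cinner (v \<epsilon> g) (u \<epsilon> g + U \<epsilon> (u \<epsilon> g)))
      \<longlongrightarrow> cinner (u0 g) (T \<cdot> u0 g)) (at_right 0)" if "g \<in> Domain St" for g
    by (rule tendsto_eventually, rule eventually_at_rightI[of 0 1]) (use form that in auto)
  ultimately show ?thesis
    by blast
qed

end
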